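(* Let $\alpha$ be an entropy rank one $\mathbb{Z}^d$-action by continuous automorphisms of a compact metrizable abelian zero-dimensional group $X$. Then there is a constant $C>0$ such that for all $\mathbf{n}\in\mathbb{Z}^d$ for which $\alpha^{\mathbf{n}}$ is ergodic, \[\mathsf{F}_\alpha(\mathbf{n})\leqslant C^{\|\mathbf{n}\|},\] where $\|\cdot\|$ is the Euclidean norm.
   Context: Entropy rank one: every $\alpha^{\mathbf{n}}$ has finite topological entropy. $\mathsf{F}_\alpha(\mathbf{n})$ is the number of $x\in X$ with $\alpha^{\mathbf{n}}(x)=x$. Ergodicity is with respect to Haar measure. *)

theory Defs
  imports "HOL-Probability.Probability" "HOL-Library.Extended_Nat"
begin

definition zero_dimensional :: "'a::topological_space set \<Rightarrow> bool" where
  "zero_dimensional X \<longleftrightarrow>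
     (\<forall>x\<in>X. \<forall>U. open U \<and> x \<in> U \<longrightarrow>
        (\<exists>V. openin (top_of_set X) V \<and> closedin (top_of_set X) V \<and> x \<in> V \<and> V \<subseteq> U))"

text \<open>Bowen's definition of topological entropy of a continuous map of a compact metric space.\<close>
definition separated :: "('a::metric_space \<Rightarrow> 'a) \<Rightarrow> nat \<Rightarrow> real \<Rightarrow> 'a set \<Rightarrow> bool" where
  "separated T n \<epsilon> E \<longleftrightarrow>
     (\<forall>x\<in>E. \<forall>y\<in>E. x \<noteq> y \<longrightarrow> (\<exists>k<n. dist ((T ^^ k) x) ((T ^^ k) y) > \<epsilon>))"

definition max_separated :: "('a::metric_space \<Rightarrow> 'a) \<Rightarrow> nat \<Rightarrow> real \<Rightarrow> enat" where
  "max_separated T n \<epsilon> = (SUP E \<in> {E. finite E \<and> separated T n \<epsilon> E}. enat (card E))"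

definition top_entropy :: "('a::metric_space \<Rightarrow> 'a) \<Rightarrow> ereal" where
  "top_entropy T = (SUP \<epsilon> \<in> {0<..}. limsup (\<lambda>n. case max_separated T n \<epsilon> of
        enat m \<Rightarrow> ereal (ln (real m) / real n) | \<infinity> \<Rightarrow> \<infinity>))"

definition haar_measure :: "'a::{ab_group_add, metric_space} measure \<Rightarrow> bool" where
  "haar_measure \<mu> \<longleftrightarrow> prob_space \<mu> \<and> sets \<mu> = sets borel \<and>
     (\<forall>x. \<forall>A\<in>sets borel. emeasure \<mu> ((\<lambda>y. x + y) ` A) = emeasure \<mu> A)"

definition ergodic :: "'a measure \<Rightarrow> ('a \<Rightarrow> 'a) \<Rightarrow> bool" where
  "ergodic \<mu> T \<longleftrightarrow> T \<in> measurable \<mu> \<mu> \<and> distr \<mu> \<mu> T = \<mu> \<and>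
     (\<forall>A\<in>sets \<mu>. T -` A \<inter> space \<mu> = A \<longrightarrow> emeasure \<mu> A = 0 \<or> emeasure \<mu> A = 1)"

text \<open>Elements of \<int>^d are functions 'd \<Rightarrow> int for a finite index type 'd (d = CARD('d)).\<close>
definition znorm :: "('d::finite \<Rightarrow> int) \<Rightarrow> real" where
  "znorm n = sqrt (\<Sum>i\<in>UNIV. (real_of_int (n i))\<^sup>2)"

definition cont_aut_action :: "(('d::finite \<Rightarrow> int) \<Rightarrow> 'a::{ab_group_add, topological_space} \<Rightarrow> 'a) \<Rightarrow> bool" where
  "cont_aut_action \<alpha> \<longleftrightarrow>
     \<alpha> (\<lambda>_. 0) = id \<and>
     (\<forall>m n. \<alpha> (\<lambda>i. m i + n i) = \<alpha> m \<circ> \<alpha> n) \<and>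
     (\<forall>n. continuous_on UNIV (\<alpha> n) \<and> bij (\<alpha> n) \<and> (\<forall>x y. \<alpha> n (x + y) = \<alpha> n x + \<alpha> n y))"

definition fixed_points :: "(('d \<Rightarrow> int) \<Rightarrow> 'a \<Rightarrow> 'a) \<Rightarrow> ('d \<Rightarrow> int) \<Rightarrow> 'a set" where
  "fixed_points \<alpha> n = {x. \<alpha> n x = x}"

end

(* For an open subgroup W and an automorphism T let c_T(W) = [W : W \<inter> T^-1 W] be the defect of W.
   If T is ergodic, then at most c_T(W) fixed points of T are distinct modulo W, because T - 1 is
   onto modulo W. The defect satisfies c_(ST) \<le> c_S c_T and c_(T^-1) = c_T, so it suffices to
   find arbitrarily small W whose defects under the generators of the action are bounded by
   constants. The growth rate of [X : W \<inter> T^-1 W \<inter> ... \<inter> T^-n W] is at most the entropy of T, so for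
   each generator the minimal defect of small W is finite and attained by iterating
   W \<mapsto> W \<inter> T^-1 W. Since W \<mapsto> c_T(W) is submodular and invariant under commuting automorphisms,
   the minima for all generators can be attained simultaneously. *)

theory Submission
  imports Defs "HOL-Library.Set_Algebras"
begin

section \<open>Subgroup indices\<close>

definition add_subgroup :: "'a::ab_group_add set \<Rightarrow> bool" where
  "add_subgroup H \<longleftrightarrow> 0 \<in> H \<and> (\<forall>x\<in>H. \<forall>y\<in>H. x - y \<in> H)"

lemma add_subgroup_zero: "add_subgroup H \<Longrightarrow> 0 \<in> H"
  and add_subgroup_diff: "add_subgroup H \<Longrightarrow> x \<in> H \<Longrightarrow> y \<in> H \<Longrightarrow> x - y \<in> H"
  by (auto simp: add_subgroup_def)

lemma add_subgroup_uminus: "add_subgroup H \<Longrightarrow> x \<in> H \<Longrightarrow> - x \<in> H"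
  using add_subgroup_diff[of H 0 x] add_subgroup_zero by auto

lemma add_subgroup_add: "add_subgroup H \<Longrightarrow> x \<in> H \<Longrightarrow> y \<in> H \<Longrightarrow> x + y \<in> H"
  using add_subgroup_diff[of H x "- y"] add_subgroup_uminus by auto

lemma add_subgroup_UNIV: "add_subgroup UNIV"
  by (simp add: add_subgroup_def)

lemma add_subgroup_Int: "add_subgroup A \<Longrightarrow> add_subgroup B \<Longrightarrow> add_subgroup (A \<inter> B)"
  by (auto simp: add_subgroup_def)

lemma add_subgroup_vimage: "Modules.additive f \<Longrightarrow> add_subgroup A \<Longrightarrow> add_subgroup (f -` A)"
  using Modules.additive.zero[of f] Modules.additive.diff[of f] by (simp add: add_subgroup_def)

lemma add_subgroup_range: "Modules.additive f \<Longrightarrow> add_subgroup (range f)"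
  using Modules.additive.zero[of f] Modules.additive.diff[of f, symmetric]
  by (auto simp: add_subgroup_def image_iff)

lemma add_subgroup_plus:
  assumes "add_subgroup A" "add_subgroup B"
  shows "add_subgroup (A + B)"
  unfolding add_subgroup_def
proof (intro conjI ballI)
  show "0 \<in> A + B"
    using set_plus_intro[OF add_subgroup_zero[OF assms(1)] add_subgroup_zero[OF assms(2)]] by simp
  fix x y assume "x \<in> A + B" "y \<in> A + B"
  then obtain a b c d where *: "x = a + b" "y = c + d" "a \<in> A" "c \<in> A" "b \<in> B" "d \<in> B"
    by (auto elim!: set_plus_elim)
  have "(a - c) + (b - d) \<in> A + B"
    using * assms by (intro set_plus_intro add_subgroup_diff)
  thus "x - y \<in> A + B" using * by (simp add: algebra_simps)
qed

lemma subset_plus_left: "add_subgroup B \<Longrightarrow> A \<subseteq> A + B"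
  by (metis add.right_neutral add_subgroup_zero set_plus_intro subsetI)

lemma subset_plus_right: "add_subgroup A \<Longrightarrow> B \<subseteq> A + B"
  by (metis add.left_neutral add_subgroup_zero set_plus_intro subsetI)

lemma plus_subset_subgroup: "add_subgroup H \<Longrightarrow> A \<subseteq> H \<Longrightarrow> B \<subseteq> H \<Longrightarrow> A + B \<subseteq> H"
  by (auto elim!: set_plus_elim intro: add_subgroup_add)

section \<open>Cosets and their number\<close>

lemma mem_coset_iff: "x \<in> a +o B \<longleftrightarrow> x - a \<in> (B :: 'a::ab_group_add set)"
proof
  assume "x - a \<in> B"
  from set_plus_intro2[OF this, of a] show "x \<in> a +o B" by simp
qed (auto simp: elt_set_plus_def)

lemma coset_eq_iff:
  assumes "add_subgroup B"
  shows "a +o B = b +o B \<longleftrightarrow> a - b \<in> B"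
proof
  assume "a +o B = b +o B"
  thus "a - b \<in> B"
    using mem_coset_iff[of a a B] mem_coset_iff[of a b B] add_subgroup_zero[OF assms] by simp
next
  assume ab: "a - b \<in> B"
  have "x - a \<in> B \<longleftrightarrow> x - b \<in> B" for x
  proof
    assume "x - a \<in> B"
    from add_subgroup_add[OF assms this ab] show "x - b \<in> B" by simp
  next
    assume "x - b \<in> B"
    from add_subgroup_diff[OF assms this ab] show "x - a \<in> B" by simp
  qed
  thus "a +o B = b +o B" by (auto simp: mem_coset_iff)
qed

definition cosets :: "'a::ab_group_add set \<Rightarrow> 'a set \<Rightarrow> 'a set set" where
  "cosets A B = (\<lambda>a. a +o B) ` A"

text \<open>\<open>B\<close> need not lie in \<open>A\<close>: for a subgroup \<open>B\<close>, the
  cosets of \<open>B\<close> that meet \<open>A\<close> are counted. An infinite index is 0 by the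
  convention of \<open>card\<close>, so positivity and inequalities below carry finiteness
  assumptions.\<close>

definition index :: "'a::ab_group_add set \<Rightarrow> 'a set \<Rightarrow> nat" where
  "index A B = card (cosets A B)"

lemma finite_cosets_UNIV: "finite (cosets UNIV B) \<Longrightarrow> finite (cosets A B)"
  by (rule finite_subset[rotated]) (auto simp: cosets_def)

lemma index_pos:
  assumes "finite (cosets UNIV B)" "A \<noteq> {}"
  shows "index A B > 0"
proof -
  have "cosets A B \<noteq> {}" using assms(2) unfolding cosets_def by blast
  thus ?thesis
    unfolding index_def card_gt_0_iff using finite_cosets_UNIV[OF assms(1)] by blast
qed

section \<open>Isomorphism theorems for indices\<close>

lemma card_image_same_kernel:
  assumes "\<And>a b. a \<in> A \<Longrightarrow> b \<in> A \<Longrightarrow> f a = f b \<longleftrightarrow> g a = g b"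
  shows "card (f ` A) = card (g ` A)"
proof (rule bij_betw_same_card)
  let ?r = "\<lambda>k. g (inv_into A f k)"
  have r: "?r (f a) = g a" if "a \<in> A" for a
    using assms[of "inv_into A f (f a)" a] that by (simp add: f_inv_into_f inv_into_into)
  show "bij_betw ?r (f ` A) (g ` A)"
    unfolding bij_betw_def
  proof
    show "inj_on ?r (f ` A)"
      using assms by (auto simp: inj_on_def r)
    show "?r ` (f ` A) = g ` A"
      using r by (force simp: image_image)
  qed
qed

lemma index_hom_image:
  assumes f: "Modules.additive f" and B: "add_subgroup B" "add_subgroup B'"
    and ker: "\<And>x y. x \<in> A \<Longrightarrow> y \<in> A \<Longrightarrow> f (x - y) \<in> B' \<longleftrightarrow> x - y \<in> B"
  shows "index A B = card ((\<lambda>a. f a +o B') ` A)"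
  unfolding index_def cosets_def
proof (rule card_image_same_kernel)
  fix a b assume "a \<in> A" "b \<in> A"
  from ker[OF this] show "a +o B = b +o B \<longleftrightarrow> f a +o B' = f b +o B'"
    by (simp only: coset_eq_iff[OF B(1)] coset_eq_iff[OF B(2)] Modules.additive.diff[OF f])
qed

text \<open>\<open>f\<close> induces a bijection from A/(A \<inter> B) onto A'/B'. Surjectivity is
  asked only modulo \<open>B'\<close>, which is the form available for \<open>T - 1\<close> in the
  count of fixed points.\<close>

lemma index_hom_eq:
  assumes "Modules.additive f" "add_subgroup A" "add_subgroup B" "add_subgroup B'"
    and mem: "\<And>x. x \<in> A \<Longrightarrow> f x \<in> A'"
    and ker: "\<And>x. x \<in> A \<Longrightarrow> f x \<in> B' \<longleftrightarrow> x \<in> B"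
    and surj: "\<And>y. y \<in> A' \<Longrightarrow> \<exists>x\<in>A. f x - y \<in> B'"
  shows "index A B = index A' B'"
proof -
  have "index A B = card ((\<lambda>a. f a +o B') ` A)"
    by (rule index_hom_image) (use assms add_subgroup_diff[OF assms(2)] in blast)+
  also have "(\<lambda>a. f a +o B') ` A = cosets A' B'"
  proof (intro equalityI subsetI)
    fix K assume "K \<in> cosets A' B'"
    then obtain y where y: "y \<in> A'" "K = y +o B'" by (auto simp: cosets_def)
    with surj obtain x where "x \<in> A" "f x - y \<in> B'" by blast
    thus "K \<in> (\<lambda>a. f a +o B') ` A"
      using y coset_eq_iff[OF \<open>add_subgroup B'\<close>] by blast
  qed (use mem in \<open>auto simp: cosets_def\<close>)
  finally show ?thesis by (simp add: index_def)
qed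

text \<open>The map induced on cosets is still injective when \<open>f\<close> is not onto modulo
  \<open>B'\<close>. Finiteness of the target excludes the value 0 that stands for an infinite
  index.\<close>

lemma index_hom_le:
  assumes "Modules.additive f" "add_subgroup A" "add_subgroup B" "add_subgroup B'"
    and mem: "\<And>x. x \<in> A \<Longrightarrow> f x \<in> A'"
    and ker: "\<And>x. x \<in> A \<Longrightarrow> f x \<in> B' \<longleftrightarrow> x \<in> B"
    and fin: "finite (cosets UNIV B')"
  shows "index A B \<le> index A' B'"
proof -
  have "index A B = card ((\<lambda>a. f a +o B') ` A)"
    by (rule index_hom_image) (use assms add_subgroup_diff[OF assms(2)] in blast)+
  also have "\<dots> \<le> card (cosets A' B')"
    by (rule card_mono[OF finite_cosets_UNIV[OF fin]]) (use mem in \<open>auto simp: cosets_def\<close>)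
  finally show ?thesis by (simp add: index_def)
qed

lemma additive_id: "Modules.additive (\<lambda>x. x)"
  by (simp add: Modules.additive_def)

text \<open>With one representative \<open>r K\<close> in each coset \<open>K\<close> of
  \<open>B\<close>, every coset of \<open>C\<close> in \<open>A\<close> is \<open>r K +o L\<close>
  for exactly one pair of \<open>K\<close> and a coset \<open>L\<close> of \<open>C\<close> in
  \<open>B\<close>. Since this is a bijection, the formula also covers infinite indices.\<close>

lemma index_mult:
  assumes "add_subgroup A" "add_subgroup B" "add_subgroup C" "C \<subseteq> B" "B \<subseteq> A"
  shows "index A C = index A B * index B C"
proof -
  define r where "r K = (SOME a. a \<in> A \<and> a +o B = K)" for K
  have r: "r K \<in> A" "r K +o B = K" if "K \<in> cosets A B" for K
  proof -
    have "\<exists>a. a \<in> A \<and> a +o B = K" using that by (auto simp: cosets_def)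
    from someI_ex[OF this] show "r K \<in> A" "r K +o B = K" by (auto simp: r_def)
  qed
  have "bij_betw (\<lambda>(K, L). r K +o L) (cosets A B \<times> cosets B C) (cosets A C)"
    unfolding bij_betw_def
  proof
    show "inj_on (\<lambda>(K, L). r K +o L) (cosets A B \<times> cosets B C)"
    proof (rule inj_onI, clarify)
      fix K L K' L'
      assume *: "K \<in> cosets A B" "L \<in> cosets B C" "K' \<in> cosets A B" "L' \<in> cosets B C"
        and eq: "r K +o L = r K' +o L'"
      from * obtain b b' where b: "b \<in> B" "L = b +o C" "b' \<in> B" "L' = b' +o C"
        by (auto simp: cosets_def)
      have d: "(r K + b) - (r K' + b') \<in> C"
        using eq b by (simp add: set_plus_rearrange2 coset_eq_iff assms)
      \<comment> \<open>Modulo \<open>B\<close> the terms \<open>b\<close> and \<open>b'\<close>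
        vanish, so \<open>K = K'\<close>. Then \<open>r K\<close> cancels and \<open>L = L'\<close>
        follows.\<close>
      have "r K - r K' = ((r K + b) - (r K' + b')) - (b - b')" by simp
      also have "\<dots> \<in> B"
        using subsetD[OF assms(4) d] b add_subgroup_diff[OF assms(2)] by blast
      finally have "r K +o B = r K' +o B" by (simp only: coset_eq_iff[OF assms(2)])
      hence "K = K'" using r(2)[OF *(1)] r(2)[OF *(3)] by simp
      with d b show "K = K' \<and> L = L'" by (simp add: coset_eq_iff assms)
    qed
    show "(\<lambda>(K, L). r K +o L) ` (cosets A B \<times> cosets B C) = cosets A C"
    proof (intro equalityI subsetI)
      fix M assume "M \<in> (\<lambda>(K, L). r K +o L) ` (cosets A B \<times> cosets B C)"
      then obtain K L where KL: "K \<in> cosets A B" "L \<in> cosets B C" "M = r K +o L" by blast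
      then obtain b where "b \<in> B" "L = b +o C" by (auto simp: cosets_def)
      with KL have *: "K \<in> cosets A B" "b \<in> B" "M = (r K + b) +o C"
        by (simp_all add: set_plus_rearrange2)
      have "r K + b \<in> A"
        using r(1)[OF *(1)] *(2) assms(5) add_subgroup_add[OF assms(1)] by blast
      thus "M \<in> cosets A C" using * by (auto simp: cosets_def)
    next
      fix M assume "M \<in> cosets A C"
      then obtain a where a: "a \<in> A" "M = a +o C" by (auto simp: cosets_def)
      define K where "K = a +o B"
      have K: "K \<in> cosets A B" using a by (auto simp: cosets_def K_def)
      have "a - r K \<in> B" using r(2)[OF K] coset_eq_iff[OF assms(2), of a "r K"] by (simp add: K_def)
      hence "(a - r K) +o C \<in> cosets B C" by (auto simp: cosets_def)
      moreover have "r K +o ((a - r K) +o C) = M" using a by (simp add: set_plus_rearrange2)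
      ultimately show "M \<in> (\<lambda>(K, L). r K +o L) ` (cosets A B \<times> cosets B C)"
        using K by (intro image_eqI[of _ _ "(K, (a - r K) +o C)"]) auto
    qed
  qed
  from bij_betw_same_card[OF this] show ?thesis
    by (simp add: index_def card_cartesian_product)
qed

lemma index_antimono:
  assumes "add_subgroup A" "add_subgroup B" "A \<subseteq> B" "finite (cosets UNIV A)"
  shows "index UNIV B \<le> index UNIV A"
proof -
  have "index B A > 0"
    using index_pos[OF assms(4)] add_subgroup_zero[OF assms(2)] by blast
  thus ?thesis
    using index_mult[OF add_subgroup_UNIV assms(2,1,3)] by simp
qed

text \<open>The second isomorphism theorem A/(A \<inter> B) = (A + B)/B, combined with
  multiplicativity of the index on both sides.\<close>

lemma index_Int_plus:
  assumes "add_subgroup A" "add_subgroup B"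
  shows "index UNIV (A \<inter> B) * index UNIV (A + B) = index UNIV A * index UNIV B"
proof -
  have "index UNIV (A \<inter> B) = index UNIV A * index A (A \<inter> B)"
    by (rule index_mult) (use assms add_subgroup_UNIV add_subgroup_Int in auto)
  moreover have "index UNIV B = index UNIV (A + B) * index (A + B) B"
    by (rule index_mult)
      (use assms add_subgroup_UNIV add_subgroup_plus[OF assms] subset_plus_right[OF assms(1)] in blast)+
  moreover have "index A (A \<inter> B) = index (A + B) B"
  proof (rule index_hom_eq[where f = "\<lambda>x. x"])
    show "x \<in> A \<Longrightarrow> x \<in> A + B" for x using subset_plus_left[OF assms(2)] by auto
    fix y assume "y \<in> A + B"
    then obtain a b where "y = a + b" "a \<in> A" "b \<in> B" by (auto elim: set_plus_elim)
    thus "\<exists>x\<in>A. x - y \<in> B" using add_subgroup_uminus[OF assms(2)] by (intro bexI[of _ a]) auto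
  qed (use assms additive_id add_subgroup_Int in auto)
  ultimately show ?thesis by simp
qed

section \<open>The defect of a subgroup under an endomorphism\<close>

definition trim :: "('a \<Rightarrow> 'a) \<Rightarrow> 'a set \<Rightarrow> 'a set" where
  "trim T W = W \<inter> T -` W"

definition defect :: "('a::ab_group_add \<Rightarrow> 'a) \<Rightarrow> 'a set \<Rightarrow> nat" where
  "defect T W = index W (trim T W)"

lemma add_subgroup_trim: "Modules.additive T \<Longrightarrow> add_subgroup W \<Longrightarrow> add_subgroup (trim T W)"
  by (simp add: trim_def add_subgroup_Int add_subgroup_vimage)

lemma index_vimage:
  assumes "Modules.additive T" "surj T" "add_subgroup A" "add_subgroup B"
  shows "index (T -` A) (T -` B) = index A B"
proof (rule index_hom_eq[where f = T])
  fix y assume "y \<in> A"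
  moreover obtain x where "y = T x" using assms(2) by blast
  ultimately show "\<exists>x\<in>T -` A. T x - y \<in> B"
    using add_subgroup_zero[OF assms(4)] by (intro bexI[of _ x]) auto
qed (use assms add_subgroup_vimage in auto)

lemma index_trim:
  "Modules.additive T \<Longrightarrow> add_subgroup W \<Longrightarrow> index UNIV (trim T W) = index UNIV W * defect T W"
  unfolding defect_def
  by (rule index_mult) (use add_subgroup_UNIV add_subgroup_trim in \<open>auto simp: trim_def\<close>)

lemma trim_mono: "W \<subseteq> V \<Longrightarrow> trim T W \<subseteq> trim T V"
  by (auto simp: trim_def)

lemma trim_subset: "trim T W \<subseteq> W"
  by (auto simp: trim_def)

text \<open>Links trimming to orbits: \<open>n\<close> trims control an orbit segment of
  \<open>n + 1\<close> points, whence \<open>Suc n\<close> in the entropy estimate.\<close>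

lemma mem_funpow_trim: "x \<in> (trim T ^^ n) W \<longleftrightarrow> (\<forall>k\<le>n. (T ^^ k) x \<in> W)"
proof (induction n arbitrary: x)
  case (Suc n)
  have "(trim T ^^ Suc n) W = trim T ((trim T ^^ n) W)" by simp
  hence "x \<in> (trim T ^^ Suc n) W \<longleftrightarrow> (\<forall>k\<le>n. (T ^^ k) x \<in> W) \<and> (\<forall>k\<le>n. (T ^^ Suc k) x \<in> W)"
    by (simp only: trim_def Int_iff vimage_eq Suc funpow_Suc_right o_apply)
  also have "\<dots> \<longleftrightarrow> (\<forall>k\<le>Suc n. (T ^^ k) x \<in> W)"
    by (metis Suc_le_mono bot_nat_0.extremum funpow_0 le_SucE not0_implies_Suc le_SucI)
  finally show ?case .
qed auto

text \<open>Trimming commutes with intersections, but for sums only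
  \<open>trim T V + trim T W\<close> \<subseteq> \<open>trim T (V + W)\<close> holds, and this
  inclusion yields the inequality. The rest is \<open>index_Int_plus\<close>, applied to
  \<open>V\<close>, \<open>W\<close> and to their trims, followed by cancellation.\<close>

lemma defect_submodular:
  assumes T: "Modules.additive T" and V: "add_subgroup V" and W: "add_subgroup W"
    and fin: "finite (cosets UNIV (trim T V \<inter> trim T W))" "finite (cosets UNIV (V \<inter> W))"
      "finite (cosets UNIV (trim T V + trim T W))" "finite (cosets UNIV (V + W))"
  shows "defect T (V \<inter> W) * defect T (V + W) \<le> defect T V * defect T W"
proof -
  let ?i = "index UNIV"
  have sub: "add_subgroup (trim T V)" "add_subgroup (trim T W)" "add_subgroup (V \<inter> W)"
    "add_subgroup (V + W)" "add_subgroup (trim T V + trim T W)" "add_subgroup (trim T (V + W))"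
    using assms by (auto intro!: add_subgroup_trim add_subgroup_Int add_subgroup_plus)
  have "trim T V + trim T W \<subseteq> trim T (V + W)"
    by (intro plus_subset_subgroup sub trim_mono subset_plus_left subset_plus_right V W)
  hence le: "?i (trim T (V + W)) \<le> ?i (trim T V + trim T W)"
    using sub fin by (intro index_antimono) auto
  have trimI: "trim T (V \<inter> W) = trim T V \<inter> trim T W" by (auto simp: trim_def)
  have pos: "?i (V \<inter> W) * ?i (V + W) > 0"
    using index_pos fin by auto
  have "(?i (V \<inter> W) * ?i (V + W)) * (defect T (V \<inter> W) * defect T (V + W))
      = ?i (trim T V \<inter> trim T W) * ?i (trim T (V + W))"
    using index_trim[OF T sub(3)] index_trim[OF T sub(4)] by (simp add: trimI)
  also have "\<dots> \<le> ?i (trim T V \<inter> trim T W) * ?i (trim T V + trim T W)"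
    using le by simp
  also have "\<dots> = ?i (trim T V) * ?i (trim T W)"
    by (rule index_Int_plus[OF sub(1,2)])
  also have "\<dots> = (?i V * ?i W) * (defect T V * defect T W)"
    using index_trim[OF T V] index_trim[OF T W] by simp
  also have "?i V * ?i W = ?i (V \<inter> W) * ?i (V + W)"
    by (rule index_Int_plus[OF V W, symmetric])
  finally show ?thesis using pos by simp
qed

text \<open>Preimages under \<open>S\<close> commute with \<open>trim T\<close>, and preimages under
  a surjective homomorphism preserve indices.\<close>

lemma defect_vimage_commute:
  assumes "Modules.additive S" "surj S" "Modules.additive T" "T \<circ> S = S \<circ> T" "add_subgroup W"
  shows "defect T (S -` W) = defect T W"
proof -
  have "trim T (S -` W) = S -` trim T W"
    using assms(4) by (auto simp: trim_def fun_eq_iff)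
  thus ?thesis unfolding defect_def
    using index_vimage[OF assms(1,2,5) add_subgroup_trim[OF assms(3,5)]] by simp
qed

lemma defect_id: "add_subgroup W \<Longrightarrow> defect id W = 1"
proof -
  assume W: "add_subgroup W"
  have "cosets W W = {W}"
    unfolding cosets_def
    using coset_eq_iff[OF W, of _ 0] add_subgroup_zero[OF W] by (auto simp: image_iff)
  thus ?thesis by (simp add: defect_def trim_def index_def)
qed

text \<open>The subgroup Z = W \<inter> T^-1 W \<inter> T^-1 S^-1 W lies in
  \<open>trim (S \<circ> T) W\<close>, so the defect is at most [W : Z]. Passing through
  \<open>trim T W\<close> splits this index into \<open>defect T W\<close> and a factor that embeds
  into T^-1 W modulo T^-1 (\<open>trim S W\<close>).\<close>

lemma defect_comp_le:
  assumes S: "Modules.additive S" and T: "Modules.additive T" "surj T" and W: "add_subgroup W"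
    and fin: "finite (cosets UNIV (trim T W \<inter> T -` trim S W))" "finite (cosets UNIV (T -` trim S W))"
  shows "defect (S \<circ> T) W \<le> defect S W * defect T W"
proof -
  let ?Z = "trim T W \<inter> T -` trim S W"
  note sub = add_subgroup_trim[OF S W] add_subgroup_trim[OF T(1) W]
  have TS: "add_subgroup (T -` trim S W)" "add_subgroup ?Z" "Modules.additive (S \<circ> T)"
    using sub S T by (auto intro!: add_subgroup_vimage add_subgroup_Int simp: Modules.additive_def)
  have "index W ?Z = defect (S \<circ> T) W * index (trim (S \<circ> T) W) ?Z"
    unfolding defect_def
    by (rule index_mult) (use W TS add_subgroup_trim[OF TS(3) W] in \<open>auto simp: trim_def\<close>)
  moreover have "index (trim (S \<circ> T) W) ?Z > 0"
    using index_pos[OF fin(1)] add_subgroup_zero[OF add_subgroup_trim[OF TS(3) W]] by blast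
  ultimately have "defect (S \<circ> T) W \<le> index W ?Z" by simp
  also have "\<dots> = defect T W * index (trim T W) ?Z"
    unfolding defect_def by (rule index_mult) (use W TS sub in \<open>auto simp: trim_def\<close>)
  also have "index (trim T W) ?Z \<le> index (T -` W) (T -` trim S W)"
    by (rule index_hom_le[where f = "\<lambda>x. x"])
      (use additive_id sub TS fin in \<open>auto simp: trim_def\<close>)
  also have "\<dots> = defect S W"
    unfolding defect_def by (rule index_vimage) (use T W sub in auto)
  finally show ?thesis by (simp only: mult.commute mult_le_mono)
qed

text \<open>\<open>W\<close> and T^-1 W have the same index in the whole group, so
  \<open>trim T W\<close> has the same index in both. In T^-1 W it is the preimage of
  \<open>trim S W\<close>.\<close>

lemma defect_inverse:
  assumes S: "Modules.additive S" and T: "Modules.additive T" "surj T" and inv: "S \<circ> T = id"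
    and W: "add_subgroup W" and fin: "finite (cosets UNIV W)"
  shows "defect S W = defect T W"
proof -
  have eq: "T -` trim S W = trim T W"
    using inv by (auto simp: trim_def fun_eq_iff)
  have "defect S W = index (T -` W) (trim T W)"
    unfolding defect_def eq[symmetric]
    by (rule index_vimage[symmetric]) (use S T W add_subgroup_trim in auto)
  moreover have "index UNIV (T -` W) = index UNIV W"
    using index_vimage[OF T add_subgroup_UNIV W] by simp
  moreover have "index UNIV (trim T W) = index UNIV (T -` W) * index (T -` W) (trim T W)"
    by (rule index_mult)
      (use T W add_subgroup_UNIV add_subgroup_trim add_subgroup_vimage in \<open>auto simp: trim_def\<close>)
  ultimately show ?thesis
    using index_trim[OF T(1) W] index_pos[OF fin, of UNIV] by simp
qed

text \<open>The inclusion of \<open>trim T W\<close> in T^-1 W is injective modulo T^-1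
  (\<open>trim T W\<close>), and preimages preserve the index. Hence defects decrease along
  successive trims.\<close>

lemma defect_trim_le:
  assumes T: "Modules.additive T" "surj T" and W: "add_subgroup W" and fin: "finite (cosets UNIV (T -` trim T W))"
  shows "defect T (trim T W) \<le> defect T W"
proof -
  note sub = add_subgroup_trim[OF T(1) W]
  have "defect T (trim T W) \<le> index (T -` W) (T -` trim T W)"
    unfolding defect_def
    by (rule index_hom_le[where f = "\<lambda>x. x"])
      (use T additive_id sub fin add_subgroup_vimage[OF T(1) sub] add_subgroup_trim[OF T(1) sub] in
        \<open>auto simp: trim_def\<close>)
  also have "\<dots> = defect T W"
    unfolding defect_def by (rule index_vimage) (use T W sub in auto)
  finally show ?thesis .
qed

section \<open>Open subgroups of compact groups\<close>

definition open_subgroup :: "'a::{ab_group_add, topological_space} set \<Rightarrow> bool" where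
  "open_subgroup W \<longleftrightarrow> open W \<and> add_subgroup W"

definition cont_aut :: "('a::{ab_group_add, topological_space} \<Rightarrow> 'a) \<Rightarrow> bool" where
  "cont_aut T \<longleftrightarrow> continuous_on UNIV T \<and> bij T \<and> Modules.additive T"

lemma cont_autD:
  assumes "cont_aut T"
  shows "Modules.additive T" "surj T" "continuous_on UNIV T"
  using assms by (auto simp: cont_aut_def bij_is_surj)

lemma open_subgroup_add_subgroup: "open_subgroup W \<Longrightarrow> add_subgroup W"
  by (simp add: open_subgroup_def)

lemma open_subgroup_UNIV: "open_subgroup UNIV"
  by (simp add: open_subgroup_def add_subgroup_UNIV)

lemma open_subgroup_Int: "open_subgroup V \<Longrightarrow> open_subgroup W \<Longrightarrow> open_subgroup (V \<inter> W)"
  by (simp add: open_subgroup_def add_subgroup_Int open_Int)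

lemma open_subgroup_INT:
  "finite I \<Longrightarrow> (\<And>i. i \<in> I \<Longrightarrow> open_subgroup (V i)) \<Longrightarrow> open_subgroup (\<Inter>i\<in>I. V i)"
  by (induction I rule: finite_induct) (auto intro: open_subgroup_Int open_subgroup_UNIV)

lemma open_subgroup_vimage: "cont_aut T \<Longrightarrow> open_subgroup W \<Longrightarrow> open_subgroup (T -` W)"
  using open_vimage[of W T] add_subgroup_vimage[of T W] by (simp add: open_subgroup_def cont_aut_def)

lemma open_subgroup_trim: "cont_aut T \<Longrightarrow> open_subgroup W \<Longrightarrow> open_subgroup (trim T W)"
  by (simp add: trim_def open_subgroup_Int open_subgroup_vimage)

lemma open_subgroup_funpow_trim:
  "cont_aut T \<Longrightarrow> open_subgroup W \<Longrightarrow> open_subgroup ((trim T ^^ n) W)"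
  by (induction n) (auto intro: open_subgroup_trim)

lemma funpow_trim_subset: "(trim T ^^ n) W \<subseteq> W"
  using trim_subset by (induction n) fastforce+

lemma funpow_trim_mono: "V \<subseteq> W \<Longrightarrow> (trim T ^^ n) V \<subseteq> (trim T ^^ n) W"
  by (induction n) (simp_all add: trim_mono)

text \<open>The type classes provide a group and a metric without relating them; the locale makes
  the whole type a compact topological group. The parameter only fixes the type.\<close>

locale compact_abelian_group =
  fixes group_type :: "'a::{ab_group_add, metric_space} itself"
  assumes add_cont: "continuous_on UNIV (\<lambda>p::'a \<times> 'a. fst p + snd p)"
    and uminus_cont: "continuous_on UNIV (\<lambda>x::'a. - x)"
    and compact: "compact (UNIV :: 'a set)"
begin

lemma translation_cont: "continuous_on UNIV (\<lambda>x::'a. a + x)"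
  using continuous_on_compose2[OF add_cont, of UNIV "\<lambda>x. (a, x)"]
  by (simp add: continuous_on_Pair)

lemma diff_cont: "continuous_on UNIV (\<lambda>p::'a \<times> 'a. fst p - snd p)"
proof -
  have "continuous_on UNIV (\<lambda>p::'a \<times> 'a. (fst p, - snd p))"
    by (intro continuous_on_Pair continuous_on_fst continuous_on_id
        continuous_on_compose2[OF uminus_cont] continuous_on_snd) auto
  from continuous_on_compose2[OF add_cont this] show ?thesis by simp
qed

lemma open_coset:
  assumes "open W"
  shows "open ((a::'a) +o W)"
proof -
  have "a +o W = (\<lambda>x. - a + x) -` W" by (auto simp: mem_coset_iff)
  thus ?thesis using open_vimage[OF assms translation_cont, of "- a"] by (simp only:)
qed

text \<open>The cosets form an open cover by pairwise disjoint nonempty sets, so a finite subcover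
  has to contain all of them.\<close>

lemma finite_cosets:
  assumes "open_subgroup (W::'a set)"
  shows "finite (cosets A W)"
proof (rule finite_cosets_UNIV)
  have W: "open W" "add_subgroup W" using assms by (auto simp: open_subgroup_def)
  have self: "a \<in> a +o W" for a
    using add_subgroup_zero[OF W(2)] by (simp add: mem_coset_iff)
  obtain D where D: "D \<subseteq> cosets UNIV W" "finite D" "UNIV \<subseteq> \<Union>D"
  proof (rule compactE[OF compact, of "cosets UNIV W"])
    show "UNIV \<subseteq> \<Union> (cosets UNIV W)" using self by (auto simp: cosets_def)
    show "\<And>B. B \<in> cosets UNIV W \<Longrightarrow> open B" using open_coset[OF W(1)] by (auto simp: cosets_def)
  qed
  have "cosets UNIV W \<subseteq> D"
  proof
    fix K assume "K \<in> cosets UNIV W"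
    then obtain a where a: "K = a +o W" by (auto simp: cosets_def)
    obtain M where M: "M \<in> D" "a \<in> M" using D(3) by auto
    then obtain b where "M = b +o W" using D(1) by (auto simp: cosets_def)
    with M a show "K \<in> D" using coset_eq_iff[OF W(2), of a b] by (simp add: mem_coset_iff)
  qed
  thus "finite (cosets UNIV W)" using D(2) finite_subset by blast
qed

lemma open_subgroup_plus:
  assumes "add_subgroup A" "open_subgroup (B::'a set)"
  shows "open_subgroup (A + B)"
proof -
  have "A + B = (\<Union>a\<in>A. a +o B)" by (auto simp: set_plus_def elt_set_plus_def)
  hence "open (A + B)"
    using assms(2) open_coset[of B] by (auto simp: open_subgroup_def)
  with assms show ?thesis by (simp add: open_subgroup_def add_subgroup_plus)
qed

section \<open>Growth of the index of open subgroups under trimming\<close>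

lemma index_UNIV_pos: "open_subgroup (W::'a set) \<Longrightarrow> index UNIV W > 0"
  by (rule index_pos[OF finite_cosets]) auto

lemma defect_pos:
  assumes "cont_aut T" "open_subgroup (W::'a set)"
  shows "defect T W > 0"
  unfolding defect_def
  using index_pos[OF finite_cosets[OF open_subgroup_trim[OF assms]], of W]
    add_subgroup_zero[OF open_subgroup_add_subgroup[OF assms(2)]] by blast

lemma index_open_trim:
  "cont_aut T \<Longrightarrow> open_subgroup W \<Longrightarrow> index UNIV (trim T W) = index UNIV (W::'a set) * defect T W"
  by (rule index_trim) (simp_all add: cont_aut_def open_subgroup_def)

lemma defect_open_trim_le:
  assumes "cont_aut T" "open_subgroup (W::'a set)"
  shows "defect T (trim T W) \<le> defect T W"
  by (rule defect_trim_le[OF _ _ _ finite_cosets])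
    (simp_all add: assms cont_autD[OF assms(1)] open_subgroup_trim open_subgroup_vimage
      open_subgroup_add_subgroup)

lemma index_funpow_trim_ge:
  assumes "cont_aut T" "open_subgroup (V::'a set)" and q: "\<And>n. q \<le> defect T ((trim T ^^ n) V)"
  shows "q ^ n * index UNIV V \<le> index UNIV ((trim T ^^ n) V)"
proof (induction n)
  case (Suc n)
  have "q ^ Suc n * index UNIV V = q * (q ^ n * index UNIV V)" by simp
  also have "\<dots> \<le> defect T ((trim T ^^ n) V) * index UNIV ((trim T ^^ n) V)"
    by (intro mult_mono q Suc) auto
  finally show ?case
    using index_open_trim[OF assms(1) open_subgroup_funpow_trim[OF assms(1,2), of n]]
    by (simp add: mult.commute)
qed auto

lemma index_funpow_trim_le:
  assumes "cont_aut T" "open_subgroup (W::'a set)"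
  shows "index UNIV ((trim T ^^ n) W) \<le> defect T W ^ n * index UNIV W"
proof (induction n)
  case (Suc n)
  have le: "defect T ((trim T ^^ n) W) \<le> defect T W" for n
  proof (induction n)
    case (Suc n)
    thus ?case using defect_open_trim_le[OF assms(1) open_subgroup_funpow_trim[OF assms, of n]] by simp
  qed auto
  have "index UNIV ((trim T ^^ Suc n) W) = index UNIV ((trim T ^^ n) W) * defect T ((trim T ^^ n) W)"
    using index_open_trim[OF assms(1) open_subgroup_funpow_trim[OF assms, of n]] by simp
  also have "\<dots> \<le> (defect T W ^ n * index UNIV W) * defect T W"
    by (intro mult_mono le Suc) auto
  finally show ?case by (simp add: mult.commute mult.left_commute)
qed auto

section \<open>Entropy bounds the growth of the index\<close>

text \<open>Subtraction is uniformly continuous on the compact group, so one \<delta> serves all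
  pairs of points.\<close>

lemma open_subgroup_separates:
  assumes "open_subgroup (V::'a set)"
  shows "\<exists>\<delta>>0. \<forall>x y. dist x y < \<delta> \<longrightarrow> x - y \<in> V"
proof -
  have V: "open V" "0 \<in> V"
    using assms add_subgroup_zero by (auto simp: open_subgroup_def)
  then obtain e where e: "e > 0" "ball 0 e \<subseteq> V" using open_contains_ball by blast
  have "compact (UNIV :: ('a \<times> 'a) set)" using compact_Times[OF compact compact] by simp
  with diff_cont have "uniformly_continuous_on UNIV (\<lambda>p::'a \<times> 'a. fst p - snd p)"
    by (rule compact_uniformly_continuous)
  then obtain d where d: "d > 0"
    "\<And>p p'::'a \<times> 'a. dist p' p < d \<Longrightarrow> dist (fst p' - snd p') (fst p - snd p) < e"
    using e(1) unfolding uniformly_continuous_on_def by (metis UNIV_I)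
  have "x - y \<in> V" if "dist x y < d" for x y
    using d(2)[of "(x, y)" "(y, y)"] that e(2) by (auto simp: dist_Pair_Pair dist_commute mem_ball)
  with d(1) show ?thesis by blast
qed

text \<open>Representatives of the cosets of the \<open>n\<close>-fold trim are separated: a
  difference outside the trim leaves \<open>V\<close> under some iterate, where the two orbits are
  then at distance at least \<delta>. Their number grows at least like the powers of
  \<open>q\<close>.\<close>

lemma ln_growth_le_top_entropy:
  assumes T: "cont_aut T" and V: "open_subgroup (V::'a set)"
    and q: "\<And>n. q \<le> defect T ((trim T ^^ n) V)" and "q \<ge> 1"
  shows "ereal (ln (real q)) \<le> top_entropy T"
proof -
  note T' = cont_autD[OF T] and V' = open_subgroup_add_subgroup[OF V]
  obtain \<delta> where \<delta>: "\<delta> > 0" "\<And>x y. dist x y < \<delta> \<Longrightarrow> x - y \<in> V"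
    using open_subgroup_separates[OF V] by blast
  have add: "Modules.additive (T ^^ k)" for k
    using T'(1) by (induction k) (auto simp: Modules.additive_def)
  \<comment> \<open>\<open>n\<close> trims contribute only \<open>q ^ n\<close>, while the orbit
    segment has length \<open>n + 1\<close>. The missing factor \<open>q\<close> comes from the
    index of \<open>V\<close> itself.\<close>
  have "defect T V \<le> index UNIV (T -` V)"
    unfolding defect_def
    using V' T' finite_cosets[OF open_subgroup_vimage[OF T V]] add_subgroup_trim[OF T'(1) V']
    by (intro index_hom_le[where f = "\<lambda>x. x"])
      (auto simp: additive_id add_subgroup_vimage trim_def)
  also have "\<dots> = index UNIV V"
    using index_vimage[OF T'(1,2) add_subgroup_UNIV V'] by simp
  finally have qV: "q \<le> index UNIV V" using q[of 0] by simp
  have sep: "enat (q ^ Suc n) \<le> max_separated T (Suc n) (\<delta> / 2)" for n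
  proof -
    let ?S = "(trim T ^^ n) V"
    have S: "open_subgroup ?S" by (rule open_subgroup_funpow_trim[OF T V])
    obtain E where E: "inj_on (\<lambda>a. a +o ?S) E" "cosets UNIV ?S = (\<lambda>a. a +o ?S) ` E"
      using subset_image_inj[of "cosets UNIV ?S" "\<lambda>a. a +o ?S" UNIV] by (auto simp: cosets_def)
    have fin: "finite E" using finite_cosets[OF S, of UNIV] E by (simp add: finite_image_iff)
    have "separated T (Suc n) (\<delta> / 2) E"
      unfolding separated_def
    proof (intro ballI impI)
      fix x y assume xy: "x \<in> E" "y \<in> E" "x \<noteq> y"
      hence "x - y \<notin> ?S"
        using E(1) coset_eq_iff[OF open_subgroup_add_subgroup[OF S]] by (auto simp: inj_on_def)
      then obtain k where k: "k \<le> n" "(T ^^ k) (x - y) \<notin> V" by (auto simp: mem_funpow_trim)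
      \<comment> \<open>This gives distance at least \<delta>, whereas \<open>separated\<close> asks
        for a strict inequality; hence the scale \<delta>/2.\<close>
      hence "\<not> dist ((T ^^ k) x) ((T ^^ k) y) < \<delta>"
        using \<delta>(2) Modules.additive.diff[OF add[of k], of x y] by metis
      with \<delta>(1) k(1) show "\<exists>k<Suc n. \<delta> / 2 < dist ((T ^^ k) x) ((T ^^ k) y)"
        by (intro exI[of _ k]) auto
    qed
    hence "enat (card E) \<le> max_separated T (Suc n) (\<delta> / 2)"
      unfolding max_separated_def using fin by (intro SUP_upper) auto
    moreover have "card E = index UNIV ?S"
      using E by (simp add: index_def card_image)
    moreover have "q ^ Suc n \<le> index UNIV ?S"
      using order_trans[OF mult_le_mono2[OF qV, of "q ^ n"] index_funpow_trim_ge[OF T V q, of n]]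
      by (simp only: power_Suc2)
    ultimately show ?thesis by (metis enat_ord_simps(1) order_trans)
  qed
  let ?h = "\<lambda>\<epsilon> n. case max_separated T n \<epsilon> of
        enat m \<Rightarrow> ereal (ln (real m) / real n) | \<infinity> \<Rightarrow> \<infinity>"
  have "ereal (ln (real q)) \<le> ?h (\<delta> / 2) n" if n: "n > 0" for n
  proof (cases "max_separated T n (\<delta> / 2)")
    case (enat m)
    obtain k where "n = Suc k" using n by (cases n) auto
    hence "q ^ n \<le> m" using sep[of k] enat by simp
    hence "real q ^ n \<le> real m" by (metis of_nat_le_iff of_nat_power)
    hence "ln (real q ^ n) \<le> ln (real m)"
      using \<open>q \<ge> 1\<close> by (intro ln_mono) auto
    hence "real n * ln (real q) \<le> ln (real m)"
      using \<open>q \<ge> 1\<close> by (simp add: ln_realpow)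
    thus ?thesis using enat n by (simp add: field_simps)
  qed auto
  hence "limsup (\<lambda>n. ereal (ln (real q))) \<le> limsup (?h (\<delta> / 2))"
    by (intro Limsup_mono eventually_mono[OF eventually_gt_at_top[of 0]]) auto
  also have "\<dots> \<le> top_entropy T"
    unfolding top_entropy_def using \<delta>(1) by (intro SUP_upper) auto
  finally show ?thesis by (simp add: Limsup_const)
qed

text \<open>\<open>q\<close> is the largest number that bounds from below all defects along the
  trims of some \<open>V\<close>; it exists because the entropy is finite. By maximality no other
  \<open>W\<close> can keep its defects above \<open>q\<close> under trimming, and growth rates show
  that no \<open>W\<close> inside \<open>V\<close> starts below \<open>q\<close>.\<close>

lemma ex_minimal_defect:
  assumes T: "cont_aut T" and ent: "top_entropy T < \<infinity>"
  shows "\<exists>q V. open_subgroup (V::'a set) \<and> (\<forall>W. open_subgroup W \<and> W \<subseteq> V \<longrightarrow>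
           q \<le> defect T W \<and> (\<exists>n. defect T ((trim T ^^ n) W) \<le> q))"
proof -
  define P where "P q \<longleftrightarrow> (\<exists>V::'a set. open_subgroup V \<and> (\<forall>n. q \<le> defect T ((trim T ^^ n) V)))" for q
  have "P 0" using open_subgroup_UNIV by (auto simp: P_def)
  define B where "B = nat \<lceil>exp (real_of_ereal (top_entropy T))\<rceil>"
  have bound: "q \<le> B" if "P q" for q
  proof (cases "q = 0")
    case False
    from that obtain V :: "'a set" where "open_subgroup V" "\<And>n. q \<le> defect T ((trim T ^^ n) V)"
      by (auto simp: P_def)
    from ln_growth_le_top_entropy[OF T this] False
    have "ereal (ln (real q)) \<le> top_entropy T" by simp
    with ent have "ln (real q) \<le> real_of_ereal (top_entropy T)"
      by (cases "top_entropy T") auto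
    hence "real q \<le> exp (real_of_ereal (top_entropy T))"
      using False ln_le_cancel_iff[of "real q" "exp (real_of_ereal (top_entropy T))"] by simp
    thus ?thesis unfolding B_def by linarith
  qed auto
  define q where "q = Greatest P"
  have "P q" unfolding q_def using \<open>P 0\<close> bound by (intro GreatestI_ex_nat[of P B]) auto
  then obtain V :: "'a set" where V: "open_subgroup V" "\<And>n. q \<le> defect T ((trim T ^^ n) V)"
    by (auto simp: P_def)
  have max: "\<not> P (Suc q)"
    using Greatest_le_nat[of P "Suc q" B] bound unfolding q_def by auto
  have "q \<le> defect T W \<and> (\<exists>n. defect T ((trim T ^^ n) W) \<le> q)" if W: "open_subgroup W" "W \<subseteq> V" for W
  proof
    from max W(1) show "\<exists>n. defect T ((trim T ^^ n) W) \<le> q"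
      unfolding P_def by (metis not_less_eq_eq)
    show "q \<le> defect T W"
    proof (rule ccontr)
      assume less: "\<not> q \<le> defect T W"
      let ?p = "defect T W"
      have p: "?p > 0" by (rule defect_pos[OF T W(1)])
      \<comment> \<open>The trims of \<open>W\<close> lie in those of \<open>V\<close>, so their
        indices grow at least like \<open>q ^ n\<close>. Defects of trims never exceed
        \<open>?p\<close>, so they grow at most like \<open>?p ^ n\<close>. This is impossible for
        \<open>?p < q\<close>.\<close>
      have "(real q / real ?p) ^ n \<le> real (index UNIV W)" for n
      proof -
        have "q ^ n \<le> q ^ n * index UNIV V"
          using index_UNIV_pos[OF V(1)] by simp
        also have "\<dots> \<le> index UNIV ((trim T ^^ n) V)"
          by (rule index_funpow_trim_ge[OF T V])
        also have "\<dots> \<le> index UNIV ((trim T ^^ n) W)"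
          by (intro index_antimono funpow_trim_mono W(2) finite_cosets open_subgroup_add_subgroup
              open_subgroup_funpow_trim T V(1) W(1))
        also have "\<dots> \<le> ?p ^ n * index UNIV W"
          by (rule index_funpow_trim_le[OF T W(1)])
        finally have "real q ^ n \<le> real ?p ^ n * real (index UNIV W)"
          by (metis of_nat_le_iff of_nat_mult of_nat_power)
        thus ?thesis using p by (simp add: power_divide field_simps)
      qed
      moreover have "real q / real ?p > 1" using less p by simp
      ultimately show False
        using real_arch_pow[of "real q / real ?p" "real (index UNIV W)"] by (meson not_le)
    qed
  qed
  with V(1) show ?thesis by blast
qed

section \<open>Subgroups of small defect for commuting automorphisms\<close>

text \<open>\<open>W\<close> and S^-1 W both have \<open>T\<close>-defect at most \<open>q\<close>,
  so submodularity bounds the product of the defects of their intersection and sum by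
  \<open>q * q\<close>. The sum lies in \<open>V\<close> and has defect at least \<open>q\<close>,
  which leaves at most \<open>q\<close> for the intersection.\<close>

lemma defect_Int_vimage_le:
  assumes T: "cont_aut T" and S: "cont_aut S" and comm: "T \<circ> S = S \<circ> T"
    and W: "open_subgroup (W::'a set)" and small: "defect T W \<le> q"
    and V: "open_subgroup V" "W \<subseteq> V" "S -` W \<subseteq> V"
    and min: "\<And>Z. open_subgroup Z \<Longrightarrow> Z \<subseteq> V \<Longrightarrow> q \<le> defect T Z"
  shows "defect T (trim S W) \<le> q"
proof -
  note T' = cont_autD[OF T] and S' = cont_autD[OF S] and W' = open_subgroup_add_subgroup[OF W]
  have SW: "open_subgroup (S -` W)" by (rule open_subgroup_vimage[OF S W])
  note SW' = open_subgroup_add_subgroup[OF SW]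
  have plus: "open_subgroup (W + S -` W)" by (rule open_subgroup_plus[OF W' SW])
  have "W + S -` W \<subseteq> V"
    by (intro plus_subset_subgroup V open_subgroup_add_subgroup)
  hence ge: "q \<le> defect T (W + S -` W)" by (rule min[OF plus])
  have "defect T (W \<inter> S -` W) * defect T (W + S -` W) \<le> defect T W * defect T (S -` W)"
    by (intro defect_submodular T' W' SW' finite_cosets open_subgroup_Int open_subgroup_plus
        open_subgroup_trim open_subgroup_add_subgroup T W SW)
  also have "defect T (S -` W) = defect T W"
    by (rule defect_vimage_commute[OF S'(1,2) T'(1) comm W'])
  finally have "defect T (trim S W) * q \<le> defect T W * defect T W"
    using mult_le_mono2[OF ge, of "defect T (trim S W)"] order_trans unfolding trim_def by blast
  also have "\<dots> \<le> q * q" by (intro mult_le_mono small)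
  finally show ?thesis
    using less_le_trans[OF defect_pos[OF T W] small] by simp
qed

text \<open>Trimming with respect to one automorphism preserves, by submodularity, the minimality of the
  defect with respect to the others, so the minima can be attained one after the other.\<close>

lemma ex_simultaneous_small_defect:
  fixes T S :: "'i \<Rightarrow> 'a \<Rightarrow> 'a"
  assumes I: "finite I" and T: "\<And>i. i \<in> I \<Longrightarrow> cont_aut (T i)"
    and S: "\<And>i. i \<in> I \<Longrightarrow> cont_aut (S i)" and inv: "\<And>i. i \<in> I \<Longrightarrow> S i \<circ> T i = id"
    and comm: "\<And>i j. i \<in> I \<Longrightarrow> j \<in> I \<Longrightarrow> T i \<circ> T j = T j \<circ> T i"
    and ent: "\<And>i. i \<in> I \<Longrightarrow> top_entropy (T i) < \<infinity>"
  shows "\<exists>q. \<forall>U. open_subgroup U \<longrightarrow>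
           (\<exists>W. open_subgroup W \<and> W \<subseteq> U \<and> (\<forall>i\<in>I. defect (T i) W \<le> q i))"
proof -
  have "\<forall>i\<in>I. \<exists>q V. open_subgroup V \<and> (\<forall>W. open_subgroup W \<and> W \<subseteq> V \<longrightarrow>
           q \<le> defect (T i) W \<and> (\<exists>n. defect (T i) ((trim (T i) ^^ n) W) \<le> q))"
    using ex_minimal_defect T ent by blast
  then obtain q V where V: "\<And>i. i \<in> I \<Longrightarrow> open_subgroup (V i)"
    and min: "\<And>i W. i \<in> I \<Longrightarrow> open_subgroup W \<Longrightarrow> W \<subseteq> V i \<Longrightarrow> q i \<le> defect (T i) W"
    and attain: "\<And>i W. i \<in> I \<Longrightarrow> open_subgroup W \<Longrightarrow> W \<subseteq> V i \<Longrightarrow>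
      \<exists>n. defect (T i) ((trim (T i) ^^ n) W) \<le> q i"
    by metis
  define V0 where "V0 = (\<Inter>i\<in>I. V i)"
  have V0: "open_subgroup V0" "\<And>i. i \<in> I \<Longrightarrow> V0 \<subseteq> V i"
    unfolding V0_def using I V by (auto intro!: open_subgroup_INT)
  \<comment> \<open>As \<open>W\<close> and all its preimages under the \<open>T j\<close> lie in
    \<open>V0\<close>, every smaller subgroup has its sum with its preimage under \<open>T j\<close>
    inside each \<open>V i\<close>, where \<open>q i\<close> is a lower bound for the
    defect.\<close>
  have step: "\<exists>W'. open_subgroup W' \<and> W' \<subseteq> W \<and> (\<forall>i\<in>J. defect (T i) W' \<le> q i)"
    if W: "open_subgroup W" "W \<subseteq> V0" "\<And>j. j \<in> I \<Longrightarrow> T j -` W \<subseteq> V0" and "J \<subseteq> I" for W J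
    using finite_subset[OF \<open>J \<subseteq> I\<close> I] \<open>J \<subseteq> I\<close>
  proof (induction J rule: finite_subset_induct')
    case empty
    thus ?case using W by blast
  next
    case (insert j J)
    then obtain W' where W': "open_subgroup W'" "W' \<subseteq> W" "\<And>i. i \<in> J \<Longrightarrow> defect (T i) W' \<le> q i"
      by blast
    have j: "j \<in> I" and JI: "J \<subseteq> I" using insert by auto
    let ?S = "\<lambda>n. (trim (T j) ^^ n) W'"
    have S: "open_subgroup (?S n)" "?S n \<subseteq> W" for n
      using open_subgroup_funpow_trim[OF T[OF j] W'(1)] funpow_trim_subset[of n "T j" W'] W'(2) by auto
    obtain n where n: "defect (T j) (?S n) \<le> q j"
      using attain[OF j W'(1)] W' W(2) V0(2)[OF j] by blast
    have "defect (T i) (?S n) \<le> q i" if i: "i \<in> J" for i n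
    proof (induction n)
      case (Suc n)
      have iI: "i \<in> I" using i JI by auto
      have "defect (T i) (trim (T j) (?S n)) \<le> q i"
      proof (rule defect_Int_vimage_le[OF T[OF iI] T[OF j] comm[OF iI j] S(1) Suc V[OF iI]])
        show "?S n \<subseteq> V i" "T j -` ?S n \<subseteq> V i"
          using S(2)[of n] W(2) W(3)[OF j] V0(2)[OF iI] by blast+
      qed (rule min[OF iI])
      thus ?case by simp
    qed (use W'(3) i in simp)
    with n S show ?case by (intro exI[of _ "?S n"]) auto
  qed
  have "\<exists>W. open_subgroup W \<and> W \<subseteq> U \<and> (\<forall>i\<in>I. defect (T i) W \<le> q i)"
    if U: "open_subgroup U" for U
  proof -
    \<comment> \<open>\<open>S j\<close> inverts \<open>T j\<close>: if \<open>T j x\<close> lies in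
      \<open>W\<close>, then \<open>x = S j (T j x)\<close> lies in \<open>V0\<close>. This puts the
      preimage of \<open>W\<close> under \<open>T j\<close> into \<open>V0\<close>.\<close>
    define W where "W = U \<inter> V0 \<inter> (\<Inter>j\<in>I. S j -` V0)"
    have "open_subgroup W" unfolding W_def
      using U V0 I S by (intro open_subgroup_Int open_subgroup_INT open_subgroup_vimage) auto
    moreover have "T j -` W \<subseteq> V0" if "j \<in> I" for j
      using fun_cong[OF inv[OF that]] that by (auto simp: W_def)
    moreover have "W \<subseteq> V0" by (auto simp: W_def)
    ultimately obtain W' where "open_subgroup W'" "W' \<subseteq> W" "\<forall>i\<in>I. defect (T i) W' \<le> q i"
      using step[of W I] by blast
    thus ?thesis by (intro exI[of _ W']) (auto simp: W_def)
  qed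
  thus ?thesis by blast
qed

section \<open>Fixed points of ergodic automorphisms\<close>

text \<open>\<open>T - 1\<close> is onto modulo \<open>W\<close>, because its range together with \<open>W\<close> spans an invariant open
  subgroup. Hence \<open>K = (T - 1)\<^sup>-\<^sup>1 W\<close> has the same index as \<open>W\<close>, contains all fixed points, and
  meets \<open>W\<close> in \<open>W \<inter> T\<^sup>-\<^sup>1 W\<close>.\<close>

lemma card_fixed_le_defect:
  assumes T: "cont_aut T"
    and erg: "\<And>H. open_subgroup (H::'a set) \<Longrightarrow> T -` H = H \<Longrightarrow> H = UNIV"
    and W: "open_subgroup W"
    and E: "\<And>x. x \<in> E \<Longrightarrow> T x = x" "\<And>x y. x \<in> E \<Longrightarrow> y \<in> E \<Longrightarrow> x - y \<in> W \<Longrightarrow> x = y"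
  shows "card E \<le> defect T W"
proof -
  note T' = cont_autD[OF T] and W' = open_subgroup_add_subgroup[OF W]
  define f where "f x = T x - x" for x
  have f: "Modules.additive f"
    using Modules.additive.add[OF T'(1)] by (simp add: f_def Modules.additive_def algebra_simps)
  define K where "K = f -` W"
  have K: "add_subgroup K" unfolding K_def by (rule add_subgroup_vimage[OF f W'])
  let ?H = "range f + W"
  have H: "open_subgroup ?H" by (rule open_subgroup_plus[OF add_subgroup_range[OF f] W])
  have H': "add_subgroup ?H" by (rule open_subgroup_add_subgroup[OF H])
  have fH: "f x \<in> ?H" for x using subset_plus_left[OF W', of "range f"] by blast
  \<comment> \<open>\<open>T x\<close> and \<open>x\<close> differ by \<open>f x\<close>, an element
    of \<open>?H\<close>, so \<open>?H\<close> is invariant and ergodicity applies.\<close>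
  have "T x \<in> ?H \<longleftrightarrow> x \<in> ?H" for x
    using add_subgroup_diff[OF H' _ fH[of x], of "T x"] add_subgroup_add[OF H' _ fH[of x], of x]
    by (auto simp: f_def)
  hence univ: "?H = UNIV" by (intro erg[OF H]) auto
  have "index UNIV K = index UNIV W"
  proof (rule index_hom_eq[OF f add_subgroup_UNIV K W'])
    fix y
    have "y \<in> ?H" using univ by simp
    then obtain x w where "y = f x + w" "w \<in> W" by (auto elim: set_plus_elim)
    thus "\<exists>x\<in>UNIV. f x - y \<in> W" using add_subgroup_uminus[OF W'] by (intro bexI[of _ x]) auto
  qed (auto simp: K_def)
  moreover have TW: "trim T W = K \<inter> W"
    using add_subgroup_diff[OF W'] add_subgroup_add[OF W']
    by (auto simp: K_def f_def trim_def) (metis diff_add_cancel)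
  moreover have "index UNIV (trim T W) = index UNIV K * index K (trim T W)"
    by (rule index_mult) (use K add_subgroup_UNIV add_subgroup_trim[OF T'(1) W'] TW in auto)
  \<comment> \<open>\<open>K\<close> and \<open>W\<close> have equal index in the group and both
    contain \<open>trim T W\<close>, so its index in \<open>K\<close> equals its index in
    \<open>W\<close>.\<close>
  ultimately have K_index: "index K (trim T W) = defect T W"
    using index_open_trim[OF T W] index_UNIV_pos[OF W] by simp
  have EK: "E \<subseteq> K" using E(1) add_subgroup_zero[OF W'] by (auto simp: K_def f_def)
  have "inj_on (\<lambda>x. x +o trim T W) E"
    using E(2) trim_subset[of T W] coset_eq_iff[OF add_subgroup_trim[OF T'(1) W']]
    by (auto simp: inj_on_def)
  hence "card E = card ((\<lambda>x. x +o trim T W) ` E)" by (simp add: card_image)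
  also have "\<dots> \<le> index K (trim T W)"
    unfolding index_def
    by (intro card_mono finite_cosets open_subgroup_trim T W) (use EK in \<open>auto simp: cosets_def\<close>)
  finally show ?thesis using K_index by simp
qed

text \<open>The finitely many cosets of \<open>H\<close> have equal Haar measure, and ergodicity
  makes it 0 or 1. Measure 0 would make the whole group null, and measure 1 leaves no room for a
  second coset.\<close>

lemma ergodic_invariant_open_subgroup:
  assumes haar: "haar_measure (\<mu> :: 'a measure)" and erg: "ergodic \<mu> T"
    and H: "open_subgroup H" "T -` H = H"
  shows "H = UNIV"
proof (rule ccontr)
  assume "H \<noteq> UNIV"
  then obtain a where a: "a \<notin> H" by blast
  interpret prob_space \<mu> using haar by (simp add: haar_measure_def)
  have sets: "sets \<mu> = sets borel" and space: "space \<mu> = UNIV"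
    using haar sets_eq_imp_space_eq[of \<mu> borel] by (auto simp: haar_measure_def)
  have open_H: "open H" and H': "add_subgroup H" using H by (auto simp: open_subgroup_def)
  have meas: "K \<in> sets \<mu>" if "K \<in> cosets UNIV H" for K
    using that open_coset[OF open_H] by (auto simp: cosets_def sets)
  have trans: "emeasure \<mu> K = emeasure \<mu> H" if K: "K \<in> cosets UNIV H" for K
  proof -
    obtain x where x: "K = (\<lambda>y. x + y) ` H"
      using K by (auto simp: cosets_def elt_set_plus_def)
    thus ?thesis using haar open_H by (auto simp: haar_measure_def)
  qed
  have "T -` H \<inter> space \<mu> = H" "H \<in> sets \<mu>" using H open_H by (auto simp: space sets)
  with erg consider "emeasure \<mu> H = 0" | "emeasure \<mu> H = 1" by (auto simp: ergodic_def)
  thus False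
  proof cases
    case 1
    have "emeasure \<mu> (\<Union>(cosets UNIV H)) \<le> (\<Sum>K\<in>cosets UNIV H. emeasure \<mu> K)"
      using emeasure_subadditive_finite[OF finite_cosets[OF H(1)], where A = "\<lambda>K. K" and M = \<mu>] meas by auto
    also have "\<dots> = 0" using trans 1 by simp
    also have "\<Union>(cosets UNIV H) = space \<mu>"
      using add_subgroup_zero[OF H'] by (auto simp: cosets_def space mem_coset_iff intro: exI)
    finally show False using emeasure_space_1 by simp
  next
    case 2
    have disj: "H \<inter> (a +o H) = {}"
    proof (rule ccontr)
      assume "H \<inter> (a +o H) \<noteq> {}"
      then obtain x where "x \<in> H" "x - a \<in> H" by (auto simp: mem_coset_iff)
      from add_subgroup_diff[OF H' this] a show False by simp
    qed
    have aH: "a +o H \<in> cosets UNIV H" by (auto simp: cosets_def)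
    have "emeasure \<mu> (H \<union> (a +o H)) = 1 + 1"
      using plus_emeasure[OF \<open>H \<in> sets \<mu>\<close> meas[OF aH] disj] trans[OF aH] 2 by simp
    moreover have "emeasure \<mu> (H \<union> (a +o H)) \<le> 1"
      using emeasure_space[of \<mu>] emeasure_space_1 by simp
    ultimately show False by simp
  qed
qed

section \<open>Small open subgroups\<close>

text \<open>The stabilizer of a compact open neighbourhood of 0 is an open subgroup contained in it.\<close>

lemma ex_open_subgroup_subset:
  assumes zd: "zero_dimensional (UNIV :: 'a set)" and N: "open N" "0 \<in> (N::'a set)"
  shows "\<exists>H. open_subgroup H \<and> H \<subseteq> N"
proof -
  obtain V where V: "open V" "closed V" "0 \<in> V" "V \<subseteq> N"
    using zd N unfolding zero_dimensional_def by fastforce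
  define H where "H = {h. \<forall>v. h + v \<in> V \<longleftrightarrow> v \<in> V}"
  have sub: "add_subgroup H"
    unfolding add_subgroup_def
  proof (intro conjI ballI)
    fix x y assume *: "x \<in> H" "y \<in> H"
    have "x - y + v \<in> V \<longleftrightarrow> v \<in> V" for v
    proof -
      have "x + (- y + v) \<in> V \<longleftrightarrow> y + (- y + v) \<in> V" using * unfolding H_def by blast
      thus ?thesis by (simp add: algebra_simps)
    qed
    thus "x - y \<in> H" by (simp add: H_def)
  qed (simp add: H_def)
  have "H \<subseteq> N"
  proof
    fix h assume "h \<in> H"
    hence "h + 0 \<in> V" using V(3) unfolding H_def by blast
    thus "h \<in> N" using V(4) by auto
  qed
  moreover have "open H"
  proof -
    \<comment> \<open>\<open>d\<close> is a Lebesgue number of the open cover by \<open>V\<close>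
      and its complement: a move by less than \<open>d\<close> cannot cross between them. Uniform
      continuity of addition then lets all small \<open>h\<close> stabilize
      \<open>V\<close>.\<close>
    obtain d where d: "d > 0" "\<And>x. \<exists>G\<in>{V, - V}. ball x d \<subseteq> G"
      by (rule Heine_Borel_lemma[OF compact, of "{V, - V}"]) (use V(1,2) in \<open>auto simp: open_Compl\<close>)
    have "compact (UNIV :: ('a \<times> 'a) set)" using compact_Times[OF compact compact] by simp
    with add_cont have "uniformly_continuous_on UNIV (\<lambda>p::'a \<times> 'a. fst p + snd p)"
      by (rule compact_uniformly_continuous)
    then obtain e where e: "e > 0"
      "\<And>p p'::'a \<times> 'a. dist p' p < e \<Longrightarrow> dist (fst p' + snd p') (fst p + snd p) < d"
      using d(1) unfolding uniformly_continuous_on_def by (metis UNIV_I)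
    have "ball 0 e \<subseteq> H"
    proof
      fix h :: 'a assume "h \<in> ball 0 e"
      hence "dist (h + v) v < d" for v
        using e(2)[of "(h, v)" "(0, v)"] by (simp add: dist_Pair_Pair dist_commute)
      hence "h + v \<in> V \<longleftrightarrow> v \<in> V" for v
        using d(2)[of "h + v"] d(1) by (auto simp: subset_iff)
      thus "h \<in> H" by (simp add: H_def)
    qed
    hence "\<exists>e>0. ball x e \<subseteq> H" if "x \<in> H" for x
    proof -
      have "open (x +o ball 0 e)" by (rule open_coset) simp
      moreover have "x +o ball 0 e \<subseteq> H"
        using \<open>ball 0 e \<subseteq> H\<close> add_subgroup_add[OF sub that] by (auto simp: elt_set_plus_def)
      moreover have "x \<in> x +o ball 0 e" using e(1) by (simp add: mem_coset_iff)
      ultimately show ?thesis using open_contains_ball by (meson order_trans)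
    qed
    thus ?thesis using open_contains_ball by blast
  qed
  ultimately show ?thesis using sub by (auto simp: open_subgroup_def)
qed

text \<open>For a finite set of fixed points, some open subgroup avoids all its nonzero differences,
  and a smaller \<open>W\<close> of defect at most \<open>N\<close> bounds its size. As
  \<open>N\<close> does not depend on the set, the set of all fixed points is finite as
  well.\<close>

lemma finite_fixed_and_card_le:
  assumes zd: "zero_dimensional (UNIV :: 'a set)" and T: "cont_aut T"
    and erg: "\<And>H. open_subgroup (H::'a set) \<Longrightarrow> T -` H = H \<Longrightarrow> H = UNIV"
    and small: "\<And>U. open_subgroup U \<Longrightarrow> \<exists>W. open_subgroup W \<and> W \<subseteq> U \<and> defect T W \<le> N"
  shows "finite {x. T x = x} \<and> card {x. T x = x} \<le> N"
proof -
  have le: "card E \<le> N" if E: "finite E" "E \<subseteq> {x. T x = x}" for E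
  proof -
    define D where "D = {x - y | x y. x \<in> E \<and> y \<in> E \<and> x \<noteq> y}"
    have "D \<subseteq> (\<lambda>(x, y). x - y) ` (E \<times> E)" by (auto simp: D_def)
    hence "finite D" using E(1) finite_surj[of "E \<times> E" D] by blast
    hence "open (- D)" by (simp add: finite_imp_closed open_Compl)
    moreover have "0 \<in> - D" by (auto simp: D_def)
    ultimately obtain U where U: "open_subgroup U" "U \<subseteq> - D"
      using ex_open_subgroup_subset[OF zd] by blast
    obtain W where W: "open_subgroup W" "W \<subseteq> U" "defect T W \<le> N" using small[OF U(1)] by blast
    have "card E \<le> defect T W"
      by (rule card_fixed_le_defect[OF T erg W(1)]) (use E U W in \<open>auto simp: D_def\<close>)
    with W(3) show ?thesis by simp
  qed
  have "finite {x. T x = x}"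
  proof (rule ccontr)
    assume "infinite {x. T x = x}"
    then obtain E where "finite E" "card E = Suc N" "E \<subseteq> {x. T x = x}"
      using infinite_arbitrarily_large by blast
    with le show False by fastforce
  qed
  with le show ?thesis by blast
qed

end

section \<open>Actions of \<open>\<int>\<^sup>d\<close>\<close>

text \<open>Induction on the word length in the generators and their inverses, which is the sum of
  the absolute values of the coordinates. Subtracting its sign from a nonzero coordinate lowers it
  by exactly one.\<close>

lemma submultiplicative_length_bound:
  fixes c :: "('d::finite \<Rightarrow> int) \<Rightarrow> nat"
  assumes zero: "c (\<lambda>_. 0) \<le> 1" and add: "\<And>m n. c (\<lambda>i. m i + n i) \<le> c m * c n"
    and gen: "\<And>i. c (\<lambda>j. if j = i then 1 else 0) \<le> Q" "\<And>i. c (\<lambda>j. if j = i then - 1 else 0) \<le> Q"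
  shows "c n \<le> Q ^ (\<Sum>i\<in>UNIV. nat \<bar>n i\<bar>)"
proof (induction "\<Sum>i\<in>UNIV. nat \<bar>n i\<bar>" arbitrary: n)
  case 0
  hence "n = (\<lambda>_. 0)" by (auto simp: fun_eq_iff)
  with zero 0 show ?case by simp
next
  case (Suc k)
  then obtain i where i: "n i \<noteq> 0" by (metis (no_types, lifting) abs_zero nat_0 nat.distinct(1) sum.neutral)
  define s :: int where "s = sgn (n i)"
  define m where "m = n(i := n i - s)"
  have "(\<Sum>j\<in>UNIV. nat \<bar>n j\<bar>) = nat \<bar>n i\<bar> + (\<Sum>j\<in>UNIV - {i}. nat \<bar>n j\<bar>)"
    "(\<Sum>j\<in>UNIV. nat \<bar>m j\<bar>) = nat \<bar>m i\<bar> + (\<Sum>j\<in>UNIV - {i}. nat \<bar>m j\<bar>)"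
    by (simp_all add: sum.remove)
  moreover have "(\<Sum>j\<in>UNIV - {i}. nat \<bar>m j\<bar>) = (\<Sum>j\<in>UNIV - {i}. nat \<bar>n j\<bar>)"
    by (rule sum.cong) (auto simp: m_def)
  moreover have "nat \<bar>n i\<bar> = Suc (nat \<bar>m i\<bar>)"
    using i by (auto simp: m_def s_def sgn_if)
  ultimately have k: "k = (\<Sum>j\<in>UNIV. nat \<bar>m j\<bar>)" using Suc(2) by simp
  have "n = (\<lambda>j. m j + (if j = i then s else 0))" by (auto simp: m_def fun_eq_iff)
  hence "c n \<le> c m * c (\<lambda>j. if j = i then s else 0)" using add by metis
  also have "\<dots> \<le> Q ^ k * Q"
  proof (rule mult_le_mono)
    show "c m \<le> Q ^ k" using Suc(1)[OF k] k by simp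
    have "s = 1 \<or> s = - 1" using i by (auto simp: s_def sgn_if)
    thus "c (\<lambda>j. if j = i then s else 0) \<le> Q" using gen[of i] by auto
  qed
  finally show ?case using Suc(2)[symmetric] by (simp add: mult.commute)
qed

lemma sum_abs_le_znorm:
  "real (\<Sum>i\<in>UNIV. nat \<bar>n i\<bar>) \<le> real CARD('d) * znorm (n :: 'd::finite \<Rightarrow> int)"
proof -
  have "real (nat \<bar>n i\<bar>) \<le> znorm n" for i
  proof -
    have "(real_of_int (n i))\<^sup>2 \<le> (\<Sum>i\<in>UNIV. (real_of_int (n i))\<^sup>2)"
      by (rule member_le_sum) auto
    hence "sqrt ((real_of_int (n i))\<^sup>2) \<le> znorm n" unfolding znorm_def by (rule real_sqrt_le_mono)
    thus ?thesis by simp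
  qed
  from sum_mono[of UNIV, OF this] show ?thesis by simp
qed

theorem theorem2p2:
  fixes \<alpha> :: "('d::finite \<Rightarrow> int) \<Rightarrow> 'a::{ab_group_add, metric_space} \<Rightarrow> 'a"
    and \<mu> :: "'a measure"
  assumes add_cont: "continuous_on UNIV (\<lambda>p::'a \<times> 'a. fst p + snd p)"
    and uminus_cont: "continuous_on UNIV (\<lambda>x::'a. - x)"
    and compact: "compact (UNIV :: 'a set)"
    and zero_dim: "zero_dimensional (UNIV :: 'a set)"
    and action: "cont_aut_action \<alpha>"
    and rank_one: "\<forall>n. top_entropy (\<alpha> n) < \<infinity>"
    and haar: "haar_measure \<mu>"
  shows "\<exists>C>0. \<forall>n. ergodic \<mu> (\<alpha> n) \<longrightarrow>
           finite (fixed_points \<alpha> n) \<and> real (card (fixed_points \<alpha> n)) \<le> C powr znorm n"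
proof -
  interpret compact_abelian_group "TYPE('a)"
    by unfold_locales (fact add_cont uminus_cont compact)+
  have id: "\<alpha> (\<lambda>_. 0) = id" and hom: "\<And>m n. \<alpha> (\<lambda>i. m i + n i) = \<alpha> m \<circ> \<alpha> n"
    and aut: "\<And>n. cont_aut (\<alpha> n)"
    using action by (auto simp: cont_aut_action_def cont_aut_def Modules.additive_def)
  define e :: "'d \<Rightarrow> 'd \<Rightarrow> int" where "e i = (\<lambda>j. if j = i then 1 else 0)" for i
  define e' :: "'d \<Rightarrow> 'd \<Rightarrow> int" where "e' i = (\<lambda>j. if j = i then - 1 else 0)" for i
  have inv: "\<alpha> (e' i) \<circ> \<alpha> (e i) = id" for i
  proof -
    have "(\<lambda>j. e' i j + e i j) = (\<lambda>_. 0)" by (auto simp: e_def e'_def)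
    thus ?thesis using hom[of "e' i" "e i"] id by simp
  qed
  have comm: "\<alpha> m \<circ> \<alpha> n = \<alpha> n \<circ> \<alpha> m" for m n
    using hom[of m n] hom[of n m] by (simp add: add.commute)
  have "\<exists>q. \<forall>U. open_subgroup U \<longrightarrow>
      (\<exists>W. open_subgroup W \<and> W \<subseteq> U \<and> (\<forall>i\<in>UNIV. defect (\<alpha> (e i)) W \<le> q i))"
    by (rule ex_simultaneous_small_defect[where S = "\<lambda>i. \<alpha> (e' i)"])
      (use aut inv comm rank_one in auto)
  then obtain q where q: "\<And>U. open_subgroup U \<Longrightarrow>
      \<exists>W. open_subgroup W \<and> W \<subseteq> U \<and> (\<forall>i. defect (\<alpha> (e i)) W \<le> q i)"
    by auto
  \<comment> \<open>The sum dominates every \<open>q i\<close>, so one constant serves all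
    generators; \<open>Suc\<close> ensures \<open>Q \<ge> 1\<close>, which makes the powers of
    \<open>Q\<close> monotone in the exponent.\<close>
  define Q where "Q = Suc (\<Sum>i\<in>UNIV. q i)"
  have qQ: "q i \<le> Q" for i
    using member_le_sum[of i UNIV q] by (simp add: Q_def)
  \<comment> \<open>The right-hand side does not involve \<open>W\<close>, so it persists while
    \<open>W\<close> shrinks.\<close>
  have bound: "defect (\<alpha> n) W \<le> Q ^ (\<Sum>i\<in>UNIV. nat \<bar>n i\<bar>)"
    if W: "open_subgroup W" "\<And>i. defect (\<alpha> (e i)) W \<le> q i" for n W
  proof (rule submultiplicative_length_bound)
    note W' = open_subgroup_add_subgroup[OF W(1)]
    show "defect (\<alpha> (\<lambda>_. 0)) W \<le> 1" by (simp add: id defect_id[OF W'])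
    show "defect (\<alpha> (\<lambda>i. m i + n i)) W \<le> defect (\<alpha> m) W * defect (\<alpha> n) W" for m n
      unfolding hom
      by (intro defect_comp_le cont_autD[OF aut] W' finite_cosets open_subgroup_Int
          open_subgroup_trim open_subgroup_vimage aut W(1))
    show "defect (\<alpha> (\<lambda>j. if j = i then 1 else 0)) W \<le> Q" for i
      using W(2)[of i] qQ[of i] by (simp add: e_def)
    show "defect (\<alpha> (\<lambda>j. if j = i then - 1 else 0)) W \<le> Q" for i
      using defect_inverse[OF cont_autD(1)[OF aut] cont_autD(1,2)[OF aut] inv[of i] W' finite_cosets[OF W(1)]]
        W(2)[of i] qQ[of i]
      by (simp add: e'_def)
  qed
  have Q: "Q > 0" by (simp add: Q_def)
  show ?thesis
  \<comment> \<open>The exponent CARD('d) pays for comparing the word length with the Euclidean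
    norm.\<close>
  proof (intro exI[of _ "real Q ^ CARD('d)"] conjI allI impI)
    show "real Q ^ CARD('d) > 0" using Q by simp
    fix n assume erg: "ergodic \<mu> (\<alpha> n)"
    let ?s = "\<Sum>i\<in>UNIV. nat \<bar>n i\<bar>"
    \<comment> \<open>Finiteness is carried along because \<open>card\<close> of an infinite set is
      0, which would make the bound vacuous.\<close>
    have *: "finite {x. \<alpha> n x = x} \<and> card {x. \<alpha> n x = x} \<le> Q ^ ?s"
    proof (rule finite_fixed_and_card_le[OF zero_dim aut])
      show "\<And>H. open_subgroup H \<Longrightarrow> \<alpha> n -` H = H \<Longrightarrow> H = UNIV"
        by (rule ergodic_invariant_open_subgroup[OF haar erg])
      show "\<And>U. open_subgroup U \<Longrightarrow> \<exists>W. open_subgroup W \<and> W \<subseteq> U \<and> defect (\<alpha> n) W \<le> Q ^ ?s"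
        using q bound by meson
    qed
    thus "finite (fixed_points \<alpha> n)" by (simp add: fixed_points_def)
    have "real (card (fixed_points \<alpha> n)) \<le> real (Q ^ ?s)"
      using * unfolding fixed_points_def by (intro of_nat_mono) auto
    also have "\<dots> = real Q powr real ?s"
      using Q by (subst powr_realpow) auto
    also have "\<dots> \<le> real Q powr (real CARD('d) * znorm n)"
      using sum_abs_le_znorm[of n] Q by (intro powr_mono) auto
    also have "\<dots> = (real Q ^ CARD('d)) powr znorm n"
      using Q by (simp add: powr_powr[symmetric] powr_realpow)
    finally show "real (card (fixed_points \<alpha> n)) \<le> (real Q ^ CARD('d)) powr znorm n" .
  qed
qed

end
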